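(* Let $u^0\in\mathbb{M}_h$ satisfy $\|u^0\|_\infty\le\beta$, and suppose the time step satisfies $$0<\tau\le\min\Big\{\frac{2h^2}{\kappa h^2+2\varepsilon^2},\ \frac{2}{\kappa+\|f'\|_{C[-\beta,\beta]}}\Big\}.$$ Then the solution generated from $u^0$ by the SS2 method with stabilization parameter $\kappa$ and time step $\tau$ satisfies $$E_h(u^{n+1})\le E_h(u^n),\qquad 0\le n\le N_t-1.$$
   Context: Problem: the two-dimensional Allen-Cahn equation $u_t=\varepsilon^2\Delta u+f(u)$ on $\Omega=(0,2\pi)^2$ with periodic boundary conditions, $t\in(0,T]$, $T>0$, $\varepsilon>0$. Assumptions on $f$: $\beta>0$ is a constant, $f$ is a real-valued function on an interval containing $[-\beta,\beta]$, continuously differentiable on $[-\beta,\beta]$; $f$ is odd and $f(\beta)=0$. $F$ is a bulk potential with $F'=-f$. Write $\|f'\|_{C[-\beta,\beta]}=\max_{\xi\in[-\beta,\beta]}|f'(\xi)|$. Grid: $M$ is a positive integer, $h=2\pi/M$. $\mathbb{M}_h$ is the space of real grid functions $v=(v_{ij})_{0\le i,j\le M-1}$ (indices extended periodically mod $M$), identified with $M\times M$ real matrices, with $\|v\|_\infty=\max_{i,j}|v_{ij}|$, $\langle v,w\rangle=h^2\sum_{i,j=0}^{M-1}v_{ij}w_{ij}$, $\|v\|=\sqrt{\langle v,v\rangle}$. The discrete gradient is $\nabla_hv_{ij}=\big(\frac{v_{i+1,j}-v_{ij}}{h},\frac{v_{i,j+1}-v_{ij}}{h}\big)^{\mathrm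 T}$, and for pairs $\bm v=(v^1,v^2)$ of grid functions $\|\bm v\|^2=\|v^1\|^2+\|v^2\|^2$. The discrete energy is $E_h(v)=\frac{\varepsilon^2}{2}\|\nabla_hv\|^2+\langle F(v),1\rangle$, with $F$ acting entrywise. $\tau>0$ is the time step, $t_n=n\tau$, $N_t=\lfloor T/\tau\rfloor$. Operators: $D_a$ is the $M\times M$ matrix (indices $0,\dots,M-1$) equal to $h^{-2}$ times the matrix with $-1$ on the diagonal, $1$ at positions $(i,i+1)$ for $0\le i\le M-2$, $1$ at position $(0,M-1)$, and zeros elsewhere (contributions at coinciding positions are added when $M\le 2$). $D_b=D_a^{\mathrm T}$. For $v\in\mathbb{M}_h$ set $\varDelta_a v=D_av+vD_a^{\mathrm T}$ and $\varDelta_b v=D_bv+vD_b^{\mathrm T}$. SS2 method with stabilization parameter $\kappa$ (a constant; $f$ acts entrywise): given $u^n$, the intermediate value $v^n$ and then $u^{n+1}$ are determined by $$\frac{v^n-u^n}{\tau/2}=\varepsilon^2(\varDelta_au^n+\varDelta_bv^n)+f(u^n)-\kappa(v^n-u^n),$$ $$\frac{u^{n+1}-v^n}{\tau/2}=\varepsilon^2(\varDelta_au^{n+1}+\varDelta_bv^n)+f(u^{n+1})+\kappa(u^{n+1}-v^n).$$ The first half step is the ESS1 method with step $\tau/2$. The second (implicit) half step is the ESS1-adjoint method with step $\tau/2$; the solution $u^{n+1}$ taken there is the one with all entries in $[-\beta,\beta]$.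
   Formalization: The stabilization parameter κ is assumed to be nonnegative; for arbitrary negative constants κ the claim fails (e.g. M=1, β=1, f(x)=(x-x³)/2, κ=-0.9, τ=20, 2ε²/h²=1, u⁰=0.1). *)

theory Defs
  imports "HOL-Analysis.Analysis" "Jordan_Normal_Form.Matrix"
begin

text \<open>Grid functions are the elements of \<^term>\<open>carrier_mat M M\<close> over the reals, with indices
  \<open>0, \<dots>, M - 1\<close>; periodic indices are reduced mod \<open>M\<close>.\<close>

definition mesh :: "nat \<Rightarrow> real" where
  "mesh M = 2 * pi / real M"

definition max_norm :: "real mat \<Rightarrow> real" where
  "max_norm v = Max (abs ` elements_mat v)"

definition grid_inner :: "nat \<Rightarrow> real mat \<Rightarrow> real mat \<Rightarrow> real" where
  "grid_inner M v w = (mesh M)\<^sup>2 * (\<Sum>i<M. \<Sum>j<M. v $$ (i, j) * w $$ (i, j))"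

definition grid_norm :: "nat \<Rightarrow> real mat \<Rightarrow> real" where
  "grid_norm M v = sqrt (grid_inner M v v)"

definition pair_norm :: "nat \<Rightarrow> real mat \<times> real mat \<Rightarrow> real" where
  "pair_norm M p = sqrt ((grid_norm M (fst p))\<^sup>2 + (grid_norm M (snd p))\<^sup>2)"

definition grid_grad :: "nat \<Rightarrow> real mat \<Rightarrow> real mat \<times> real mat" where
  "grid_grad M v =
    (mat M M (\<lambda>(i, j). (v $$ ((i + 1) mod M, j) - v $$ (i, j)) / mesh M),
     mat M M (\<lambda>(i, j). (v $$ (i, (j + 1) mod M) - v $$ (i, j)) / mesh M))"

definition grid_one :: "nat \<Rightarrow> real mat" where
  "grid_one M = mat M M (\<lambda>_. 1)"

definition discrete_energy :: "nat \<Rightarrow> real \<Rightarrow> (real \<Rightarrow> real) \<Rightarrow> real mat \<Rightarrow> real" where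
  "discrete_energy M \<epsilon> F v =
    \<epsilon>\<^sup>2 / 2 * (pair_norm M (grid_grad M v))\<^sup>2 + grid_inner M (map_mat F v) (grid_one M)"

text \<open>The three summands are added, not chosen between: for \<open>M \<le> 2\<close> the corner position
  \<open>(0, M - 1)\<close> coincides with a diagonal or superdiagonal position.\<close>

definition D_a :: "nat \<Rightarrow> real mat" where
  "D_a M = (1 / (mesh M)\<^sup>2) \<cdot>\<^sub>m mat M M (\<lambda>(i, j).
     (if i = j then - 1 else 0) + (if j = i + 1 then 1 else 0)
     + (if i = 0 \<and> j = M - 1 then 1 else 0))"

definition D_b :: "nat \<Rightarrow> real mat" where
  "D_b M = transpose_mat (D_a M)"

definition Delta_a :: "nat \<Rightarrow> real mat \<Rightarrow> real mat" where
  "Delta_a M v = D_a M * v + v * transpose_mat (D_a M)"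

definition Delta_b :: "nat \<Rightarrow> real mat \<Rightarrow> real mat" where
  "Delta_b M v = D_b M * v + v * transpose_mat (D_b M)"

text \<open>One step of size \<open>s\<close> of the ESS1 method and of its adjoint; the reaction term is taken
  at the old level in the former and at the new level in the latter.\<close>

definition ess1_step ::
  "nat \<Rightarrow> real \<Rightarrow> (real \<Rightarrow> real) \<Rightarrow> real \<Rightarrow> real \<Rightarrow> real mat \<Rightarrow> real mat \<Rightarrow> bool" where
  "ess1_step M \<epsilon> f \<kappa> s u v \<longleftrightarrow>
     (1 / s) \<cdot>\<^sub>m (v - u) =
       \<epsilon>\<^sup>2 \<cdot>\<^sub>m (Delta_a M u + Delta_b M v) + map_mat f u - \<kappa> \<cdot>\<^sub>m (v - u)"

definition ess1_adjoint_step ::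
  "nat \<Rightarrow> real \<Rightarrow> (real \<Rightarrow> real) \<Rightarrow> real \<Rightarrow> real \<Rightarrow> real mat \<Rightarrow> real mat \<Rightarrow> bool" where
  "ess1_adjoint_step M \<epsilon> f \<kappa> s v w \<longleftrightarrow>
     (1 / s) \<cdot>\<^sub>m (w - v) =
       \<epsilon>\<^sup>2 \<cdot>\<^sub>m (Delta_a M w + Delta_b M v) + map_mat f w + \<kappa> \<cdot>\<^sub>m (w - v)"

text \<open>\<open>u\<close> is the sequence produced by \<open>N\<close> SS2 steps of size \<open>\<tau>\<close> from \<open>u0\<close>. The implicit half step
  is solved within \<open>[-\<beta>, \<beta>]\<close>, which is part of the scheme; the intermediate value \<open>v\<close> is
  subject to no bound.\<close>

definition ss2_solution ::
  "nat \<Rightarrow> real \<Rightarrow> (real \<Rightarrow> real) \<Rightarrow> real \<Rightarrow> real \<Rightarrow> real \<Rightarrow> real mat \<Rightarrow> nat \<Rightarrow> (nat \<Rightarrow> real mat) \<Rightarrow> bool"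
  where
  "ss2_solution M \<epsilon> f \<beta> \<kappa> \<tau> u0 N u \<longleftrightarrow>
     u 0 = u0 \<and>
     (\<forall>n<N. u (n + 1) \<in> carrier_mat M M \<and> max_norm (u (n + 1)) \<le> \<beta> \<and>
       (\<exists>v \<in> carrier_mat M M.
          ess1_step M \<epsilon> f \<kappa> (\<tau> / 2) (u n) v \<and>
          ess1_adjoint_step M \<epsilon> f \<kappa> (\<tau> / 2) v (u (n + 1))))"

text \<open>For continuous \<open>g\<close> and \<open>a \<le> b\<close> the supremum is the maximum.\<close>

definition C_norm :: "real \<Rightarrow> real \<Rightarrow> (real \<Rightarrow> real) \<Rightarrow> real" where
  "C_norm a b g = (SUP x\<in>{a..b}. \<bar>g x\<bar>)"

end

theory Submission
  imports Defs
begin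

text \<open>
  Write \<open>u\<close>, \<open>v\<close>, \<open>w\<close> for \<open>u\<^sup>n\<close>, \<open>v\<^sup>n\<close>, \<open>u\<^sup>n\<^sup>+\<^sup>1\<close>, \<open>s = \<tau> / 2\<close>, and let \<open>L\<close> be the maximum of
  \<open>\<bar>f'\<bar>\<close> on \<open>[-\<beta>, \<beta>]\<close>.  The one-sided operators are adjoint to each other, and
  \<open>\<langle>v, \<Delta>\<^sub>a v\<rangle> = - \<parallel>\<nabla>v\<parallel>\<^sup>2 / 2\<close>.  Hence in \<open>\<langle>v - u, \<Delta>\<^sub>a u + \<Delta>\<^sub>b v\<rangle>\<close> the mixed terms cancel and
  only a difference of gradient energies is left (lemma \<open>grid_inner_split_increment\<close>); the same
  happens in the second half step.  Testing each half step with its own increment therefore gives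
  exact balances for the gradient energy, with the dissipation terms
  \<open>(1/s + \<kappa>) \<parallel>v - u\<parallel>\<^sup>2\<close> and \<open>(1/s - \<kappa>) \<parallel>w - v\<parallel>\<^sup>2\<close>, and with the work \<open>\<langle>f(u), v - u\<rangle>\<close> and
  \<open>\<langle>f(w), w - v\<rangle>\<close> of the reaction term.

  This work must compensate the change of the bulk potential up to \<open>L/2\<close> times the squared
  increments.  If \<open>v\<close> took values in \<open>[-\<beta>, \<beta>]\<close>, that would be a first-order Taylor estimate for
  \<open>F\<close>, based at \<open>u\<close> and at \<open>w\<close> respectively.  But \<open>v\<close> may leave \<open>[-\<beta>, \<beta>]\<close>, where \<open>L\<close> bounds
  nothing.  What saves the argument is that \<open>F(v)\<close> cancels when the two estimates are added, and
  that the resulting upper bound for \<open>F(w) - F(u)\<close> only grows when \<open>v\<close> moves away from the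
  interval between \<open>u\<close> and \<open>w\<close>, because \<open>f\<close> is \<open>L\<close>-Lipschitz (lemma
  \<open>two_step_descent_inequality\<close>).  So the bound holds for arbitrary \<open>v\<close>.

  Altogether the energy drops by at least
  \<open>(1/s + \<kappa> - L/2) \<parallel>v - u\<parallel>\<^sup>2 + (1/s - \<kappa> - L/2) \<parallel>w - v\<parallel>\<^sup>2\<close>, and \<open>\<tau> \<le> 2 / (\<kappa> + L)\<close> says
  \<open>1/s \<ge> \<kappa> + L\<close>, which makes both coefficients nonnegative.
\<close>

section \<open>The grid inner product\<close>

lemma grid_inner_commute: "grid_inner M v w = grid_inner M w v"
  by (simp add: grid_inner_def mult.commute)

lemma grid_inner_add_right:
  assumes "a \<in> carrier_mat M M" "b \<in> carrier_mat M M"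
  shows "grid_inner M v (a + b) = grid_inner M v a + grid_inner M v b"
  using assms by (simp add: grid_inner_def algebra_simps sum.distrib)

lemma grid_inner_diff_right:
  assumes "a \<in> carrier_mat M M" "b \<in> carrier_mat M M"
  shows "grid_inner M v (a - b) = grid_inner M v a - grid_inner M v b"
  using assms by (simp add: grid_inner_def algebra_simps sum_subtractf)

lemma grid_inner_smult_right:
  assumes "a \<in> carrier_mat M M"
  shows "grid_inner M v (c \<cdot>\<^sub>m a) = c * grid_inner M v a"
  using assms by (simp add: grid_inner_def sum_distrib_left algebra_simps)

lemma grid_inner_diff_left:
  assumes "a \<in> carrier_mat M M" "b \<in> carrier_mat M M"
  shows "grid_inner M (a - b) v = grid_inner M a v - grid_inner M b v"
  using grid_inner_diff_right[OF assms] by (simp add: grid_inner_commute)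

lemma grid_inner_self_nonneg: "grid_inner M v v \<ge> 0"
  by (simp add: grid_inner_def sum_nonneg)

lemma grid_norm_squared: "(grid_norm M v)\<^sup>2 = grid_inner M v v"
  by (simp add: grid_norm_def grid_inner_self_nonneg)

lemma mult_mat_entry:
  assumes "A \<in> carrier_mat M M" "B \<in> carrier_mat M M" "i < M" "j < M"
  shows "(A * B) $$ (i, j) = (\<Sum>k<M. A $$ (i, k) * B $$ (k, j))"
  using assms by (simp add: scalar_prod_def lessThan_atLeast0)

text \<open>The column index is summed outermost, so that for each fixed column the form is a quadratic or
  bilinear form of the matrix \<open>A\<close> alone.\<close>

lemma grid_inner_mult_left:
  assumes "A \<in> carrier_mat M M" "v \<in> carrier_mat M M" "w \<in> carrier_mat M M"
  shows "grid_inner M w (A * v) =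
    (mesh M)\<^sup>2 * (\<Sum>j<M. \<Sum>i<M. \<Sum>k<M. w $$ (i, j) * A $$ (i, k) * v $$ (k, j))"
proof -
  have "grid_inner M w (A * v) =
      (mesh M)\<^sup>2 * (\<Sum>i<M. \<Sum>j<M. \<Sum>k<M. w $$ (i, j) * A $$ (i, k) * v $$ (k, j))"
    unfolding grid_inner_def
    using assms by (simp add: mult_mat_entry[OF assms(1,2)] sum_distrib_left mult.assoc
        del: index_mult_mat)
  also have "(\<Sum>i<M. \<Sum>j<M. \<Sum>k<M. w $$ (i, j) * A $$ (i, k) * v $$ (k, j)) =
      (\<Sum>j<M. \<Sum>i<M. \<Sum>k<M. w $$ (i, j) * A $$ (i, k) * v $$ (k, j))"
    by (rule sum.swap)
  finally show ?thesis .
qed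

lemma grid_inner_mult_right_transpose:
  assumes "A \<in> carrier_mat M M" "v \<in> carrier_mat M M" "w \<in> carrier_mat M M"
  shows "grid_inner M w (v * transpose_mat A) =
    (mesh M)\<^sup>2 * (\<Sum>i<M. \<Sum>j<M. \<Sum>k<M. w $$ (i, j) * A $$ (j, k) * v $$ (i, k))"
proof -
  have "grid_inner M w (v * transpose_mat A) =
      (mesh M)\<^sup>2 * (\<Sum>i<M. \<Sum>j<M. w $$ (i, j) * (\<Sum>k<M. v $$ (i, k) * transpose_mat A $$ (k, j)))"
    unfolding grid_inner_def
    using assms by (simp add: mult_mat_entry[where A = v and M = M] del: index_mult_mat index_transpose_mat)
  then show ?thesis
    using assms by (simp add: sum_distrib_left mult_ac)
qed

lemma grid_inner_transpose_mult_left: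
  assumes "A \<in> carrier_mat M M" "v \<in> carrier_mat M M" "w \<in> carrier_mat M M"
  shows "grid_inner M w (transpose_mat A * v) = grid_inner M v (A * w)"
proof -
  have "(\<Sum>i<M. \<Sum>k<M. w $$ (i, j) * transpose_mat A $$ (i, k) * v $$ (k, j)) =
      (\<Sum>i<M. \<Sum>k<M. v $$ (i, j) * A $$ (i, k) * w $$ (k, j))" if "j < M" for j
    using assms by (subst sum.swap) (simp add: mult_ac)
  then show ?thesis
    using assms by (simp add: grid_inner_mult_left)
qed

lemma grid_inner_mult_right_transpose_swap:
  assumes "A \<in> carrier_mat M M" "v \<in> carrier_mat M M" "w \<in> carrier_mat M M"
  shows "grid_inner M w (v * transpose_mat (transpose_mat A)) = grid_inner M v (w * transpose_mat A)"
proof -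
  have "(\<Sum>j<M. \<Sum>k<M. w $$ (i, j) * transpose_mat A $$ (j, k) * v $$ (i, k)) =
      (\<Sum>j<M. \<Sum>k<M. v $$ (i, j) * A $$ (j, k) * w $$ (i, k))" if "i < M" for i
    using assms by (subst sum.swap) (simp add: mult_ac)
  then show ?thesis
    using assms by (simp add: grid_inner_mult_right_transpose[of "transpose_mat A"]
        grid_inner_mult_right_transpose[of A] del: transpose_transpose)
qed

section \<open>The one-sided operators and the discrete gradient\<close>

lemma D_a_carrier [simp]: "D_a M \<in> carrier_mat M M"
  by (simp add: D_a_def)

lemma Delta_a_carrier [simp]: "v \<in> carrier_mat M M \<Longrightarrow> Delta_a M v \<in> carrier_mat M M"
  by (auto simp: Delta_a_def intro!: add_carrier_mat mult_carrier_mat[of _ M M])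

lemma Delta_b_carrier [simp]: "v \<in> carrier_mat M M \<Longrightarrow> Delta_b M v \<in> carrier_mat M M"
  by (auto simp: Delta_b_def D_b_def intro!: add_carrier_mat mult_carrier_mat[of _ M M])

lemma Delta_b_adjoint:
  assumes "v \<in> carrier_mat M M" "w \<in> carrier_mat M M"
  shows "grid_inner M w (Delta_b M v) = grid_inner M v (Delta_a M w)"
proof -
  have c: "D_a M * x \<in> carrier_mat M M" "x * D_a M \<in> carrier_mat M M"
    "transpose_mat (D_a M) * x \<in> carrier_mat M M" "x * transpose_mat (D_a M) \<in> carrier_mat M M"
    if "x \<in> carrier_mat M M" for x
    using that by (auto intro!: mult_carrier_mat[of _ M M])
  show ?thesis
    using assms grid_inner_transpose_mult_left[OF D_a_carrier assms]
      grid_inner_mult_right_transpose_swap[OF D_a_carrier assms]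
    by (simp add: Delta_a_def Delta_b_def D_b_def grid_inner_add_right c)
qed

text \<open>Summation by parts on the cyclic group: the coefficients on the left form an upper triangular
  matrix, whose corner entry couples \<open>x 0\<close> to \<open>x (M - 1)\<close> from the "wrong" side.  A quadratic form
  only sees the symmetric part of its matrix, and that is half the periodic second difference.\<close>

lemma cyclic_difference_form:
  fixes x :: "nat \<Rightarrow> real"
  assumes "M > 0"
  shows "(\<Sum>i<M. \<Sum>k<M. x i * ((if i = k then - 1 else 0) + (if k = i + 1 then 1 else 0)
       + (if i = 0 \<and> k = M - 1 then 1 else 0)) * x k)
     = - (1 / 2) * (\<Sum>i<M. (x ((i + 1) mod M) - x i)\<^sup>2)"
proof -
  obtain m where M: "M = Suc m"
    using assms gr0_implies_Suc by blast
  have diag: "(\<Sum>i<M. \<Sum>k<M. x i * (if i = k then - 1 else 0) * x k) = - (\<Sum>i<M. (x i)\<^sup>2)"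
    by (simp add: if_distrib[of "\<lambda>c. _ * c * _"] sum_negf power2_eq_square cong: if_cong)
  have "(\<Sum>i<M. \<Sum>k<M. x i * (if k = i + 1 then 1 else 0) * x k)
      = (\<Sum>i<M. if i < m then x i * x (i + 1) else 0)"
    by (intro sum.cong) (auto simp: M if_distrib[of "\<lambda>c. _ * c * _"] cong: if_cong)
  then have super: "(\<Sum>i<M. \<Sum>k<M. x i * (if k = i + 1 then 1 else 0) * x k)
      = (\<Sum>i<m. x i * x (i + 1))"
    by (simp add: M)
  have "(\<Sum>i<M. \<Sum>k<M. x i * (if i = 0 \<and> k = M - 1 then 1 else 0) * x k)
      = (\<Sum>i<M. if i = 0 then x 0 * x m else 0)"
    by (intro sum.cong) (auto simp: M if_distrib[of "\<lambda>c. _ * c * _"] cong: if_cong)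
  then have corner: "(\<Sum>i<M. \<Sum>k<M. x i * (if i = 0 \<and> k = M - 1 then 1 else 0) * x k) = x 0 * x m"
    by (simp add: M)
  have cyc: "(\<Sum>i<M. g i ((i + 1) mod M)) = (\<Sum>i<m. g i (i + 1)) + g m 0" for g :: "nat \<Rightarrow> nat \<Rightarrow> real"
    by (simp add: M)
  have shift: "(\<Sum>i<m. (x (i + 1))\<^sup>2) + (x 0)\<^sup>2 = (\<Sum>i<M. (x i)\<^sup>2)"
    unfolding M by (subst sum.lessThan_Suc_shift) simp
  have "(\<Sum>i<M. (x ((i + 1) mod M) - x i)\<^sup>2)
      = (\<Sum>i<m. (x (i + 1))\<^sup>2) + (x 0)\<^sup>2 + ((\<Sum>i<m. (x i)\<^sup>2) + (x m)\<^sup>2)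
        - 2 * ((\<Sum>i<m. x i * x (i + 1)) + x 0 * x m)"
    by (subst cyc[of "\<lambda>i k. (x k - x i)\<^sup>2"])
      (simp add: power2_diff sum.distrib sum_subtractf sum_distrib_left algebra_simps)
  also have "\<dots> = 2 * (\<Sum>i<M. (x i)\<^sup>2) - 2 * ((\<Sum>i<m. x i * x (i + 1)) + x 0 * x m)"
    unfolding shift by (simp add: M)
  finally show ?thesis
    by (simp only: distrib_left distrib_right sum.distrib diag super corner) (simp add: field_simps)
qed

lemma grid_inner_Delta_a:
  assumes "M > 0" "v \<in> carrier_mat M M"
  shows "grid_inner M v (Delta_a M v) = - (1 / 2) * (pair_norm M (grid_grad M v))\<^sup>2"
proof -
  let ?d = "\<lambda>i k. (if i = k then - 1 else 0) + (if k = i + 1 then 1 else 0)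
       + (if i = 0 \<and> k = M - 1 then 1 else (0::real))"
  let ?h = "mesh M"
  have h: "?h \<noteq> 0"
    using assms(1) by (simp add: mesh_def)
  have D: "D_a M $$ (i, k) = ?d i k / ?h\<^sup>2" if "i < M" "k < M" for i k
    using that by (simp add: D_a_def)
  have form: "(\<Sum>i<M. \<Sum>k<M. x i * D_a M $$ (i, k) * x k)
      = - (1 / 2) * (\<Sum>i<M. ((x ((i + 1) mod M) - x i) / ?h)\<^sup>2)" for x :: "nat \<Rightarrow> real"
  proof -
    have "(\<Sum>i<M. \<Sum>k<M. x i * D_a M $$ (i, k) * x k)
        = (\<Sum>i<M. \<Sum>k<M. x i * ?d i k * x k) / ?h\<^sup>2"
      unfolding sum_divide_distrib by (intro sum.cong refl) (simp only: D lessThan_iff times_divide_eq_right times_divide_eq_left)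
    then show ?thesis
      unfolding cyclic_difference_form[OF assms(1)]
      by (simp add: power_divide sum_divide_distrib mult.commute)
  qed
  have c: "D_a M * v \<in> carrier_mat M M" "v * transpose_mat (D_a M) \<in> carrier_mat M M"
    using assms by (auto intro!: mult_carrier_mat[of _ M M])
  have 1: "grid_inner M v (D_a M * v) = - (1 / 2) * (grid_norm M (fst (grid_grad M v)))\<^sup>2"
  proof -
    have "grid_inner M v (D_a M * v) = ?h\<^sup>2 * (\<Sum>j<M. - (1 / 2) *
        (\<Sum>i<M. ((v $$ ((i + 1) mod M, j) - v $$ (i, j)) / ?h)\<^sup>2))"
      using grid_inner_mult_left[OF D_a_carrier assms(2) assms(2)] form[of "\<lambda>i. v $$ (i, _)"] by simp
    also have "\<dots> = - (1 / 2) * (?h\<^sup>2 * (\<Sum>j<M. \<Sum>i<M.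
        ((v $$ ((i + 1) mod M, j) - v $$ (i, j)) / ?h)\<^sup>2))"
      by (simp only: sum_distrib_left[symmetric] mult.left_commute)
    also have "(\<Sum>j<M. \<Sum>i<M. ((v $$ ((i + 1) mod M, j) - v $$ (i, j)) / ?h)\<^sup>2)
        = (\<Sum>i<M. \<Sum>j<M. ((v $$ ((i + 1) mod M, j) - v $$ (i, j)) / ?h)\<^sup>2)"
      by (rule sum.swap)
    finally show ?thesis
      unfolding grid_norm_squared by (simp add: grid_inner_def grid_grad_def power2_eq_square)
  qed
  have 2: "grid_inner M v (v * transpose_mat (D_a M))
      = - (1 / 2) * (grid_norm M (snd (grid_grad M v)))\<^sup>2"
  proof -
    have "grid_inner M v (v * transpose_mat (D_a M)) = ?h\<^sup>2 * (\<Sum>i<M. - (1 / 2) *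
        (\<Sum>j<M. ((v $$ (i, (j + 1) mod M) - v $$ (i, j)) / ?h)\<^sup>2))"
      using grid_inner_mult_right_transpose[OF D_a_carrier assms(2) assms(2)]
        form[of "\<lambda>j. v $$ (_, j)"] by simp
    also have "\<dots> = - (1 / 2) * (?h\<^sup>2 * (\<Sum>i<M. \<Sum>j<M.
        ((v $$ (i, (j + 1) mod M) - v $$ (i, j)) / ?h)\<^sup>2))"
      by (simp only: sum_distrib_left[symmetric] mult.left_commute)
    finally show ?thesis
      unfolding grid_norm_squared by (simp add: grid_inner_def grid_grad_def power2_eq_square)
  qed
  have "(pair_norm M (grid_grad M v))\<^sup>2
      = (grid_norm M (fst (grid_grad M v)))\<^sup>2 + (grid_norm M (snd (grid_grad M v)))\<^sup>2"
    by (simp add: pair_norm_def)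
  then show ?thesis
    by (simp add: Delta_a_def grid_inner_add_right[OF c] 1 2 field_simps)
qed

text \<open>The mixed terms \<open>\<langle>w, \<Delta>\<^sub>b v\<rangle>\<close> and \<open>\<langle>v, \<Delta>\<^sub>a w\<rangle>\<close> cancel by adjointness.  Both ways of
  distributing the two operators over the old and the new value occur, one in each half step.\<close>

lemma grid_inner_split_increment:
  assumes "M > 0" "v \<in> carrier_mat M M" "w \<in> carrier_mat M M"
  shows "grid_inner M (w - v) (Delta_a M w + Delta_b M v)
    = ((pair_norm M (grid_grad M v))\<^sup>2 - (pair_norm M (grid_grad M w))\<^sup>2) / 2"
    and "grid_inner M (w - v) (Delta_a M v + Delta_b M w)
    = ((pair_norm M (grid_grad M v))\<^sup>2 - (pair_norm M (grid_grad M w))\<^sup>2) / 2"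
  using assms
  by (simp_all add: grid_inner_add_right grid_inner_diff_left Delta_b_adjoint grid_inner_Delta_a
      field_simps)

section \<open>The two half steps\<close>

text \<open>The half steps tested with their own increments.  Since \<open>\<kappa>\<close> enters them with opposite signs,
  it adds to the dissipation of the explicit half step and takes from that of the implicit one.\<close>

lemma ess1_step_balance:
  assumes "M > 0" "u \<in> carrier_mat M M" "v \<in> carrier_mat M M"
    and "ess1_step M \<epsilon> f \<kappa> s u v"
  shows "\<epsilon>\<^sup>2 / 2 * ((pair_norm M (grid_grad M v))\<^sup>2 - (pair_norm M (grid_grad M u))\<^sup>2)
    = grid_inner M (v - u) (map_mat f u) - (1 / s + \<kappa>) * grid_inner M (v - u) (v - u)"
proof -
  have d: "v - u \<in> carrier_mat M M"
    using assms by (simp add: minus_carrier_mat)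
  have "grid_inner M (v - u) ((1 / s) \<cdot>\<^sub>m (v - u)) = grid_inner M (v - u)
      (\<epsilon>\<^sup>2 \<cdot>\<^sub>m (Delta_a M u + Delta_b M v) + map_mat f u - \<kappa> \<cdot>\<^sub>m (v - u))"
    using assms(4) by (simp add: ess1_step_def)
  also have "\<dots> = \<epsilon>\<^sup>2 * grid_inner M (v - u) (Delta_a M u + Delta_b M v)
      + grid_inner M (v - u) (map_mat f u) - \<kappa> * grid_inner M (v - u) (v - u)"
    using assms d by (simp add: grid_inner_diff_right grid_inner_add_right[of "_ \<cdot>\<^sub>m _"] grid_inner_smult_right)
  finally show ?thesis
    using grid_inner_split_increment(2)[OF assms(1-3)] d
    by (simp add: grid_inner_smult_right field_simps)
qed

lemma ess1_adjoint_step_balance: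
  assumes "M > 0" "v \<in> carrier_mat M M" "w \<in> carrier_mat M M"
    and "ess1_adjoint_step M \<epsilon> f \<kappa> s v w"
  shows "\<epsilon>\<^sup>2 / 2 * ((pair_norm M (grid_grad M w))\<^sup>2 - (pair_norm M (grid_grad M v))\<^sup>2)
    = grid_inner M (w - v) (map_mat f w) - (1 / s - \<kappa>) * grid_inner M (w - v) (w - v)"
proof -
  have d: "w - v \<in> carrier_mat M M"
    using assms by (simp add: minus_carrier_mat)
  have "grid_inner M (w - v) ((1 / s) \<cdot>\<^sub>m (w - v)) = grid_inner M (w - v)
      (\<epsilon>\<^sup>2 \<cdot>\<^sub>m (Delta_a M w + Delta_b M v) + map_mat f w + \<kappa> \<cdot>\<^sub>m (w - v))"
    using assms(4) by (simp add: ess1_adjoint_step_def)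
  also have "\<dots> = \<epsilon>\<^sup>2 * grid_inner M (w - v) (Delta_a M w + Delta_b M v)
      + grid_inner M (w - v) (map_mat f w) + \<kappa> * grid_inner M (w - v) (w - v)"
    using assms d by (simp add: grid_inner_add_right[of "_ \<cdot>\<^sub>m _"]
        grid_inner_add_right[of "_ + _"] grid_inner_smult_right)
  finally show ?thesis
    using grid_inner_split_increment(1)[OF assms(1-3)] d
    by (simp add: grid_inner_smult_right field_simps)
qed

section \<open>The potential along the two half steps\<close>

text \<open>Continuity makes the set of values bounded; the supremum of an unbounded set would carry no
  information.\<close>

lemma C_norm_bounds:
  assumes "continuous_on {a..b} g" "x \<in> {a..b}"
  shows "\<bar>g x\<bar> \<le> C_norm a b g"
proof -
  have "compact ((\<lambda>x. \<bar>g x\<bar>) ` {a..b})"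
    using assms(1) by (intro compact_continuous_image continuous_intros) auto
  then have "bdd_above ((\<lambda>x. \<bar>g x\<bar>) ` {a..b})"
    by (simp add: bounded_imp_bdd_above compact_imp_bounded)
  then show ?thesis
    unfolding C_norm_def using assms(2) by (rule cSUP_upper2) simp
qed

lemma C_norm_Lipschitz:
  assumes "a \<le> b"
    and "\<forall>x\<in>{a..b}. (f has_real_derivative f' x) (at x within {a..b})"
    and "continuous_on {a..b} f'"
  shows "(C_norm a b f')-lipschitz_on {a..b} f"
proof (rule lipschitz_onI)
  fix x y assume "x \<in> {a..b}" "y \<in> {a..b}"
  then have "norm (f x - f y) \<le> C_norm a b f' * norm (x - y)"
    using assms(2) C_norm_bounds[OF assms(3)]
    by (intro field_differentiable_bound[of "{a..b}" f f']) auto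
  then show "dist (f x) (f y) \<le> C_norm a b f' * dist x y"
    by (simp add: dist_norm)
next
  show "0 \<le> C_norm a b f'"
    using C_norm_bounds[OF assms(3), of a] assms(1) abs_ge_zero[of "f' a"] by simp
qed

text \<open>The first-order Taylor estimate for a function whose derivative \<open>- f\<close> is only known to be
  Lipschitz: subtracting the right-hand side from \<open>F\<close> leaves a function that increases up to \<open>x\<close> and decreases
  beyond it.\<close>

lemma descent_inequality:
  fixes f F :: "real \<Rightarrow> real"
  assumes F: "\<forall>z\<in>S. (F has_real_derivative - f z) (at z within S)"
    and f: "L-lipschitz_on S f"
    and S: "is_interval S" "x \<in> S" "y \<in> S"
  shows "F y - F x \<le> - f x * (y - x) + L / 2 * (y - x)\<^sup>2"
proof -
  define g where "g z = F z + f x * z - L / 2 * (z - x)\<^sup>2" for z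
  have dg: "(g has_derivative (*) (f x - f z - L * (z - x))) (at z within S)" if "z \<in> S" for z
    unfolding g_def has_field_derivative_def[symmetric]
    by (rule derivative_eq_intros F[rule_format, OF that] refl | simp)+
  have lip: "\<bar>f x - f z\<bar> \<le> L * \<bar>x - z\<bar>" if "z \<in> S" for z
    using lipschitz_onD[OF f S(2) that] by (simp add: dist_real_def)
  have mvt: "\<exists>z\<in>{p..q}. g q - g p = (f x - f z - L * (z - x)) * (q - p)"
    if "p \<le> q" "{p..q} \<subseteq> S" for p q
    using that by (intro mvt_very_simple has_derivative_subset[OF dg]) auto
  have "g y \<le> g x"
  proof (cases "x \<le> y")
    case True
    have sub: "{x..y} \<subseteq> S"
      using mem_is_interval_1_I[OF S] by auto
    obtain z where z: "z \<in> {x..y}" "g y - g x = (f x - f z - L * (z - x)) * (y - x)"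
      using mvt[OF True sub] by blast
    have "z \<in> S" "\<bar>x - z\<bar> = z - x"
      using z(1) sub by auto
    then have "f x - f z - L * (z - x) \<le> 0"
      using lip[of z] by simp
    then have "g y - g x \<le> 0"
      unfolding z(2) using True by (intro mult_nonpos_nonneg) auto
    then show ?thesis
      by simp
  next
    case False
    have sub: "{y..x} \<subseteq> S"
      using mem_is_interval_1_I[OF S(1,3,2)] by auto
    obtain z where z: "z \<in> {y..x}" "g x - g y = (f x - f z - L * (z - x)) * (x - y)"
      using mvt[OF _ sub] False by fastforce
    have "z \<in> S" "\<bar>x - z\<bar> = x - z"
      using z(1) sub by auto
    moreover have "L * (z - x) = - (L * (x - z))"
      by (simp add: algebra_simps)
    ultimately have "f x - f z - L * (z - x) \<ge> 0"
      using lip[of z] by linarith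
    then have "g x - g y \<ge> 0"
      unfolding z(2) using False by (intro mult_nonneg_nonneg) auto
    then show ?thesis
      by simp
  qed
  then show ?thesis
    by (simp add: g_def algebra_simps)
qed

text \<open>Here \<open>z\<close> is arbitrary.  For \<open>z\<close> between \<open>x\<close> and \<open>y\<close> the two estimates of
  \<open>descent_inequality\<close> based at \<open>x\<close> (for \<open>F\<close>) and at \<open>y\<close> (for \<open>- F\<close>) add up to the claim.  The
  right-hand side is a convex quadratic in \<open>z\<close> with derivative \<open>f y - f x + L * (2 * z - x - y)\<close>;
  by the Lipschitz bound this is nonpositive at \<open>min x y\<close> and nonnegative at \<open>max x y\<close>, so moving
  \<open>z\<close> outward from there cannot violate the inequality.\<close>

lemma two_step_descent_inequality:
  fixes f F :: "real \<Rightarrow> real"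
  assumes F: "\<forall>z\<in>S. (F has_real_derivative - f z) (at z within S)"
    and f: "L-lipschitz_on S f"
    and S: "is_interval S" "x \<in> S" "y \<in> S"
  shows "F y - F x \<le> - f x * (z - x) - f y * (y - z) + L / 2 * ((z - x)\<^sup>2 + (y - z)\<^sup>2)"
proof -
  define \<phi> where "\<phi> z = - f x * (z - x) - f y * (y - z) + L / 2 * ((z - x)\<^sup>2 + (y - z)\<^sup>2)" for z
  have inside: "F y - F x \<le> \<phi> z" if "z \<in> S" for z
  proof -
    have "F z - F x \<le> - f x * (z - x) + L / 2 * (z - x)\<^sup>2"
      by (rule descent_inequality[OF F f S(1,2) that])
    moreover
    have "((\<lambda>t. - F t) has_real_derivative - (- f t)) (at t within S)" if "t \<in> S" for t
      by (intro derivative_intros F[rule_format, OF that])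
    then have "- F z - - F y \<le> - (- f y) * (z - y) + L / 2 * (z - y)\<^sup>2"
      using f S that by (intro descent_inequality[where S = S] ballI) auto
    ultimately show ?thesis
      by (simp add: \<phi>_def algebra_simps power2_commute[of z y])
  qed
  \<comment> \<open>The secant slope of the quadratic, used with \<open>m\<close> the endpoint nearest to \<open>z\<close>.\<close>
  have diff: "\<phi> z - \<phi> m = (z - m) * (f y - f x + L * ((z - x) + (m - y)))" for z m
    unfolding \<phi>_def by (simp add: power2_eq_square field_simps)
  have lip: "\<bar>f x - f y\<bar> \<le> L * \<bar>x - y\<bar>" and L: "0 \<le> L"
    using lipschitz_onD[OF f S(2,3)] lipschitz_on_nonneg[OF f] by (auto simp: dist_real_def)
  have bd: "\<bar>f x - f y\<bar> \<le> L * d" if "\<bar>x - y\<bar> \<le> d" for d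
    using lip mult_left_mono[OF that L] by linarith
  consider "z < min x y" | "max x y < z" | "min x y \<le> z" "z \<le> max x y"
    by linarith
  then have "F y - F x \<le> \<phi> z"
  proof cases
    case 1
    have "\<bar>x - y\<bar> \<le> - ((z - x) + (min x y - y))"
      using 1 by (auto simp: min_def)
    from bd[OF this] have "f y - f x + L * ((z - x) + (min x y - y)) \<le> 0"
      by (simp add: algebra_simps)
    then have "0 \<le> \<phi> z - \<phi> (min x y)"
      unfolding diff using 1 by (intro mult_nonpos_nonpos) auto
    moreover have "F y - F x \<le> \<phi> (min x y)"
      using S by (intro inside) (simp add: min_def)
    ultimately show ?thesis
      by linarith
  next
    case 2
    have "\<bar>x - y\<bar> \<le> (z - x) + (max x y - y)"
      using 2 by (auto simp: max_def)
    from bd[OF this] have "0 \<le> f y - f x + L * ((z - x) + (max x y - y))"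
      by (simp add: algebra_simps)
    then have "0 \<le> \<phi> z - \<phi> (max x y)"
      unfolding diff using 2 by (intro mult_nonneg_nonneg) auto
    moreover have "F y - F x \<le> \<phi> (max x y)"
      using S by (intro inside) (simp add: max_def)
    ultimately show ?thesis
      by linarith
  next
    case 3
    then have "z \<in> S"
      using mem_is_interval_1_I[OF S] mem_is_interval_1_I[OF S(1,3,2)]
      by (cases "x \<le> y") (auto simp: min_def max_def)
    then show ?thesis
      by (rule inside)
  qed
  then show ?thesis
    by (simp add: \<phi>_def)
qed

lemma grid_inner_map_one:
  assumes "v \<in> carrier_mat M M"
  shows "grid_inner M (map_mat F v) (grid_one M) = (mesh M)\<^sup>2 * (\<Sum>i<M. \<Sum>j<M. F (v $$ (i, j)))"
  using assms by (simp add: grid_inner_def grid_one_def)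

lemma max_norm_entry:
  assumes "v \<in> carrier_mat M M" "max_norm v \<le> b" "i < M" "j < M"
  shows "\<bar>v $$ (i, j)\<bar> \<le> b"
proof -
  have "finite (elements_mat v)"
    by (simp add: elements_mat_def)
  moreover have "v $$ (i, j) \<in> elements_mat v"
    using assms by (intro elements_matI) auto
  ultimately have "\<bar>v $$ (i, j)\<bar> \<le> max_norm v"
    unfolding max_norm_def by (intro Max_ge) auto
  with assms(2) show ?thesis
    by linarith
qed

text \<open>The two-step inequality summed over the grid; the entries of \<open>v\<close> may lie outside \<open>S\<close>.\<close>

lemma grid_two_step_descent:
  fixes f F :: "real \<Rightarrow> real"
  assumes F: "\<forall>z\<in>S. (F has_real_derivative - f z) (at z within S)"
    and f: "L-lipschitz_on S f"
    and S: "is_interval S"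
    and carrier: "u \<in> carrier_mat M M" "v \<in> carrier_mat M M" "w \<in> carrier_mat M M"
    and uS: "\<And>i j. i < M \<Longrightarrow> j < M \<Longrightarrow> u $$ (i, j) \<in> S"
    and wS: "\<And>i j. i < M \<Longrightarrow> j < M \<Longrightarrow> w $$ (i, j) \<in> S"
  shows "grid_inner M (map_mat F w) (grid_one M) - grid_inner M (map_mat F u) (grid_one M)
    \<le> - grid_inner M (v - u) (map_mat f u) - grid_inner M (w - v) (map_mat f w)
      + L / 2 * (grid_inner M (v - u) (v - u) + grid_inner M (w - v) (w - v))"
proof -
  let ?a = "\<lambda>i j. v $$ (i, j) - u $$ (i, j)" and ?b = "\<lambda>i j. w $$ (i, j) - v $$ (i, j)"
  let ?r = "\<lambda>i j. - (?a i j * f (u $$ (i, j))) - ?b i j * f (w $$ (i, j))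
      + L / 2 * (?a i j * ?a i j + ?b i j * ?b i j)"
  have "F (w $$ (i, j)) - F (u $$ (i, j)) \<le> ?r i j" if "i < M" "j < M" for i j
    using two_step_descent_inequality[OF F f S uS[OF that] wS[OF that], of "v $$ (i, j)"]
    by (simp only: power2_eq_square mult.commute mult_minus_left mult_minus_right)
  then have "(\<Sum>i<M. \<Sum>j<M. F (w $$ (i, j)) - F (u $$ (i, j))) \<le> (\<Sum>i<M. \<Sum>j<M. ?r i j)"
    by (intro sum_mono) auto
  then have "(mesh M)\<^sup>2 * (\<Sum>i<M. \<Sum>j<M. F (w $$ (i, j)) - F (u $$ (i, j)))
      \<le> (mesh M)\<^sup>2 * (\<Sum>i<M. \<Sum>j<M. ?r i j)"
    by (rule mult_left_mono) simp
  moreover have "(mesh M)\<^sup>2 * (\<Sum>i<M. \<Sum>j<M. ?r i j) =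
      - grid_inner M (v - u) (map_mat f u) - grid_inner M (w - v) (map_mat f w)
      + L / 2 * (grid_inner M (v - u) (v - u) + grid_inner M (w - v) (w - v))"
  proof -
    have "(\<Sum>i<M. \<Sum>j<M. ?r i j)
        = - (\<Sum>i<M. \<Sum>j<M. ?a i j * f (u $$ (i, j))) - (\<Sum>i<M. \<Sum>j<M. ?b i j * f (w $$ (i, j)))
          + L / 2 * ((\<Sum>i<M. \<Sum>j<M. ?a i j * ?a i j) + (\<Sum>i<M. \<Sum>j<M. ?b i j * ?b i j))"
      by (simp only: sum.distrib sum_subtractf sum_negf sum_distrib_left[symmetric])
    moreover have
      "grid_inner M (v - u) (map_mat f u) = (mesh M)\<^sup>2 * (\<Sum>i<M. \<Sum>j<M. ?a i j * f (u $$ (i, j)))"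
      "grid_inner M (w - v) (map_mat f w) = (mesh M)\<^sup>2 * (\<Sum>i<M. \<Sum>j<M. ?b i j * f (w $$ (i, j)))"
      "grid_inner M (v - u) (v - u) = (mesh M)\<^sup>2 * (\<Sum>i<M. \<Sum>j<M. ?a i j * ?a i j)"
      "grid_inner M (w - v) (w - v) = (mesh M)\<^sup>2 * (\<Sum>i<M. \<Sum>j<M. ?b i j * ?b i j)"
      using carrier by (simp_all add: grid_inner_def)
    ultimately show ?thesis
      by (simp only:) (simp only: algebra_simps)
  qed
  ultimately show ?thesis
    using carrier by (simp add: grid_inner_map_one sum_subtractf right_diff_distrib)
qed

section \<open>Energy dissipation\<close>

text \<open>In the sum of the two balances and the potential estimate, the reaction work and the gradient
  energy of \<open>v\<close> cancel.\<close>

lemma ss2_step_energy_dissipation: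
  fixes f F :: "real \<Rightarrow> real"
  assumes "M > 0"
    and carrier: "u \<in> carrier_mat M M" "v \<in> carrier_mat M M" "w \<in> carrier_mat M M"
    and steps: "ess1_step M \<epsilon> f \<kappa> s u v" "ess1_adjoint_step M \<epsilon> f \<kappa> s v w"
    and F: "\<forall>z\<in>S. (F has_real_derivative - f z) (at z within S)"
    and f: "L-lipschitz_on S f"
    and S: "is_interval S"
    and uS: "\<And>i j. i < M \<Longrightarrow> j < M \<Longrightarrow> u $$ (i, j) \<in> S"
    and wS: "\<And>i j. i < M \<Longrightarrow> j < M \<Longrightarrow> w $$ (i, j) \<in> S"
  shows "discrete_energy M \<epsilon> F w - discrete_energy M \<epsilon> F u
    \<le> - (1 / s + \<kappa> - L / 2) * (grid_norm M (v - u))\<^sup>2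
       - (1 / s - \<kappa> - L / 2) * (grid_norm M (w - v))\<^sup>2"
  using ess1_step_balance[OF assms(1) carrier(1,2) steps(1)]
    ess1_adjoint_step_balance[OF assms(1) carrier(2,3) steps(2)]
    grid_two_step_descent[OF F f S carrier uS wS]
  by (simp add: discrete_energy_def grid_norm_squared algebra_simps)

theorem theorem3p7:
  fixes M :: nat
    and \<epsilon> \<beta> \<kappa> \<tau> T :: real
    and I :: "real set"
    and f f' F :: "real \<Rightarrow> real"
    and u0 :: "real mat"
    and u :: "nat \<Rightarrow> real mat"
  assumes "M > 0" and "\<epsilon> > 0" and "T > 0" and "\<beta> > 0" and "\<kappa> \<ge> 0"
    and "is_interval I" and "{- \<beta>..\<beta>} \<subseteq> I"
    and "\<forall>x\<in>I. - x \<in> I \<longrightarrow> f (- x) = - f x"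
    and "f \<beta> = 0"
    and "\<forall>x\<in>{- \<beta>..\<beta>}. (f has_real_derivative f' x) (at x within {- \<beta>..\<beta>})"
    and "continuous_on {- \<beta>..\<beta>} f'"
    and "\<forall>x\<in>I. (F has_real_derivative - f x) (at x within I)"
    and "u0 \<in> carrier_mat M M" and "max_norm u0 \<le> \<beta>"
    and "0 < \<tau>"
    and "\<tau> \<le> min (2 * (mesh M)\<^sup>2 / (\<kappa> * (mesh M)\<^sup>2 + 2 * \<epsilon>\<^sup>2)) (2 / (\<kappa> + C_norm (- \<beta>) \<beta> f'))"
    and "ss2_solution M \<epsilon> f \<beta> \<kappa> \<tau> u0 (nat \<lfloor>T / \<tau>\<rfloor>) u"
  shows "\<forall>n<nat \<lfloor>T / \<tau>\<rfloor>. discrete_energy M \<epsilon> F (u (n + 1)) \<le> discrete_energy M \<epsilon> F (u n)"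
proof (intro allI impI)
  fix n assume n: "n < nat \<lfloor>T / \<tau>\<rfloor>"
  let ?S = "{- \<beta>..\<beta>}"
  define L where "L = C_norm (- \<beta>) \<beta> f'"
  have lip: "L-lipschitz_on ?S f"
    unfolding L_def using assms(4,10,11) by (intro C_norm_Lipschitz) auto
  then have L: "0 \<le> L"
    by (rule lipschitz_on_nonneg)
  have F: "\<forall>x\<in>?S. (F has_real_derivative - f x) (at x within ?S)"
    using assms(7,12) by (meson DERIV_subset subsetD)
  note sol = assms(17)[unfolded ss2_solution_def]
  have bounded: "u k \<in> carrier_mat M M \<and> max_norm (u k) \<le> \<beta>" if "k \<le> nat \<lfloor>T / \<tau>\<rfloor>" for k
    using that sol assms(13,14) by (cases k) auto
  have mem: "u k $$ (i, j) \<in> ?S" if "k \<le> nat \<lfloor>T / \<tau>\<rfloor>" "i < M" "j < M" for k i j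
    using max_norm_entry[of "u k" M \<beta> i j] bounded[OF that(1)] that(2,3) by (auto simp: abs_le_iff)
  obtain v where v: "v \<in> carrier_mat M M" "ess1_step M \<epsilon> f \<kappa> (\<tau> / 2) (u n) v"
      "ess1_adjoint_step M \<epsilon> f \<kappa> (\<tau> / 2) v (u (n + 1))"
    using sol n by blast
  \<comment> \<open>The time step bound excludes \<open>\<kappa> + L = 0\<close>, as the quotient would then be \<open>0\<close>.\<close>
  have "\<tau> \<le> 2 / (\<kappa> + L)"
    using assms(16) by (simp add: L_def)
  then have "\<tau> \<le> 2 / (\<kappa> + L)" "0 < 2 / (\<kappa> + L)"
    using assms(15) by linarith+
  then have rate: "\<kappa> + L \<le> 1 / (\<tau> / 2)"
    using assms(15) by (auto simp: zero_less_divide_iff field_simps)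
  have "discrete_energy M \<epsilon> F (u (n + 1)) - discrete_energy M \<epsilon> F (u n)
      \<le> - (1 / (\<tau> / 2) + \<kappa> - L / 2) * (grid_norm M (v - u n))\<^sup>2
         - (1 / (\<tau> / 2) - \<kappa> - L / 2) * (grid_norm M (u (n + 1) - v))\<^sup>2"
    using n v bounded mem
    by (intro ss2_step_energy_dissipation[OF assms(1) _ _ _ _ _ F lip]) auto
  also have "\<dots> \<le> 0"
  proof -
    have "0 \<le> 1 / (\<tau> / 2) + \<kappa> - L / 2" "0 \<le> 1 / (\<tau> / 2) - \<kappa> - L / 2"
      using rate L assms(5) by linarith+
    then have "0 \<le> (1 / (\<tau> / 2) + \<kappa> - L / 2) * (grid_norm M (v - u n))\<^sup>2"
      "0 \<le> (1 / (\<tau> / 2) - \<kappa> - L / 2) * (grid_norm M (u (n + 1) - v))\<^sup>2"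
      by simp_all
    then show ?thesis
      by linarith
  qed
  finally show "discrete_energy M \<epsilon> F (u (n + 1)) \<le> discrete_energy M \<epsilon> F (u n)"
    by simp
qed

end
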